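(* Let $D$ be a (nonempty, finite) local tournament. Then the following hold. (a) For each $i\in\{1,2\}$, $D$ has a Sullivan-$i$ vertex. (b) If $D$ has no vertex of in-degree zero, then $D$ has at least two Sullivan-1 vertices. (c) If $D$ has no vertex of in-degree zero, then either $D$ has at least two Sullivan-2 vertices, or $D$ has a Sullivan-2 vertex $v$ satisfying $d^{++}(v)+d^{+}(v)\geq 2d^{-}(v)+2$.
   Context: All digraphs are finite, without loops and without multiple arcs. For a vertex $x$ of a digraph $D$, $N^{+}(x)$ and $N^{-}(x)$ are the sets of out-neighbours and in-neighbours of $x$, $d^{+}(x)=|N^{+}(x)|$, $d^{-}(x)=|N^{-}(x)|$; the second out-neighbourhood is $N^{++}(x)=\bigcup_{u\in N^{+}(x)}N^{+}(u)-N^{+}(x)$ and $d^{++}(x)=|N^{++}(x)|$. A digraph is semicomplete if for every pair of distinct vertices $x,y$ at least one of $xy$, $yx$ is an arc. A digraph is locally semicomplete if for every vertex $x$ the subdigraphs induced by $N^{+}(x)$ and by $N^{-}(x)$ are both semicomplete. A local tournament is a locally semicomplete digraph with no 2-cycle. A vertex $x$ of $D$ is a Sullivan-1 vertex of $D$ if $d^{++}(x)\geq d^{-}(x)$, and a Sullivan-2 vertex of $D$ if $d^{++}(x)+d^{+}(x)\geq 2d^{-}(x)$. *)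

theory Defs
  imports "Graph_Theory.Digraph_Component"
begin

definition out_nbrs :: "('a,'b) pre_digraph \<Rightarrow> 'a \<Rightarrow> 'a set" where
  "out_nbrs G x = {y. x \<rightarrow>\<^bsub>G\<^esub> y}"

definition in_nbrs :: "('a,'b) pre_digraph \<Rightarrow> 'a \<Rightarrow> 'a set" where
  "in_nbrs G x = {y. y \<rightarrow>\<^bsub>G\<^esub> x}"

text \<open>In a digraph with 2-cycles this set may contain \<open>x\<close> itself; in a local tournament it cannot.\<close>

definition second_out_nbrs :: "('a,'b) pre_digraph \<Rightarrow> 'a \<Rightarrow> 'a set" where
  "second_out_nbrs G x = (\<Union>u\<in>out_nbrs G x. out_nbrs G u) - out_nbrs G x"

definition second_out_degree :: "('a,'b) pre_digraph \<Rightarrow> 'a \<Rightarrow> nat" where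
  "second_out_degree G x = card (second_out_nbrs G x)"

text \<open>
  The degrees \<^const>\<open>out_degree\<close> and \<^const>\<open>in_degree\<close> count arcs. In the absence of
  parallel arcs they are the cardinalities of the neighbourhoods.
\<close>

lemma (in nomulti_digraph) out_degree_eq_card_out_nbrs:
  "out_degree G x = card (out_nbrs G x)"
proof -
  have "out_nbrs G x = head G ` out_arcs G x"
    by (auto simp: out_nbrs_def arcs_ends_conv)
  moreover have "inj_on (head G) (out_arcs G x)"
    by (auto simp: inj_on_def arc_to_ends_def intro: no_multi_arcs)
  ultimately show ?thesis
    by (simp add: out_degree_def card_image)
qed

lemma (in nomulti_digraph) in_degree_eq_card_in_nbrs:
  "in_degree G x = card (in_nbrs G x)"
proof -
  have "in_nbrs G x = tail G ` in_arcs G x"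
    by (auto simp: in_nbrs_def arcs_ends_conv)
  moreover have "inj_on (tail G) (in_arcs G x)"
    by (auto simp: inj_on_def arc_to_ends_def intro: no_multi_arcs)
  ultimately show ?thesis
    by (simp add: in_degree_def card_image)
qed

locale semicomplete_digraph = digraph +
  assumes semicomplete:
    "\<lbrakk>x \<in> verts G; y \<in> verts G; x \<noteq> y\<rbrakk> \<Longrightarrow> x \<rightarrow> y \<or> y \<rightarrow> x"

locale locally_semicomplete_digraph = digraph +
  assumes out_semicomplete:
    "x \<in> verts G \<Longrightarrow> semicomplete_digraph (G \<restriction> out_nbrs G x)"
  and in_semicomplete:
    "x \<in> verts G \<Longrightarrow> semicomplete_digraph (G \<restriction> in_nbrs G x)"

locale local_tournament = locally_semicomplete_digraph +
  assumes no_two_cycle: "x \<rightarrow> y \<Longrightarrow> \<not> y \<rightarrow> x"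

definition sullivan1_vertex :: "('a,'b) pre_digraph \<Rightarrow> 'a \<Rightarrow> bool" where
  "sullivan1_vertex G x \<longleftrightarrow> x \<in> verts G \<and> second_out_degree G x \<ge> in_degree G x"

definition sullivan2_vertex :: "('a,'b) pre_digraph \<Rightarrow> 'a \<Rightarrow> bool" where
  "sullivan2_vertex G x \<longleftrightarrow>
     x \<in> verts G \<and> second_out_degree G x + out_degree G x \<ge> 2 * in_degree G x"

end

theory Submission
  imports Defs
begin

text \<open>
  Write \<open>r(x)\<close> for the number of vertices at distance one or two from \<open>x\<close>, so that \<open>x\<close> is
  Sullivan-1 iff \<open>r(x) \<ge> d\<^sup>+(x) + d\<^sup>-(x)\<close> and Sullivan-2 iff \<open>r(x) \<ge> 2d\<^sup>-(x)\<close>. A minimal nonempty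
  set \<open>C\<close> closed under in-neighbours induces a strong digraph; its vertices keep their in-degree
  in \<open>D\<close>, while out-degrees and second out-degrees in \<open>D\<close> are no smaller than inside \<open>C\<close>. So it is
  enough to find the vertices when \<open>D\<close> is strong.

  Sullivan-1. The in-neighbours of \<open>x\<close> form a tournament, and a king \<open>u\<close> of it reaches in two steps
  \<open>x\<close>, all out-neighbours of \<open>x\<close> and all other in-neighbours of \<open>x\<close>. Hence
  \<open>r(u) \<ge> d\<^sup>+(x) + d\<^sup>-(x)\<close> (\<open>reach_king_of_In\<close>), and a vertex with \<open>r\<close> maximal is Sullivan-1. If it were
  the only one, the vertices with the second largest value of \<open>r\<close> would be so rigid that one of
  them, together with the vertices it reaches, would be a proper set without leaving arcs
  (\<open>two_sullivan1\<close>).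

  Sullivan-2. In a tournament a vertex of maximum out-degree works. Otherwise let \<open>\<kappa>\<close> be the
  least size of a set \<open>S\<close> of all in-neighbours from outside of a set \<open>X\<close>, where some vertex outside
  \<open>X \<union> S\<close> is not adjacent to some vertex of \<open>X\<close>, and take such an \<open>X\<close> as small as possible. Then \<open>X\<close> is
  a tournament, \<open>S\<close> dominates \<open>X\<close>, and \<open>X\<close> dominates the set \<open>O\<close> of its outer out-neighbours. A vertex \<open>x\<close>
  of maximum out-degree in \<open>X\<close> has \<open>2d\<^sup>-(x) \<le> 2\<kappa> + |X| - 1\<close> and \<open>r(x) \<ge> |X| - 1 + |O| + |O\<^sub>2|\<close>, where
  \<open>O\<^sub>2\<close> is the set of new out-neighbours of \<open>O\<close>. The complement of \<open>X \<union> O\<close> is entered only through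
  \<open>O\<close>, and the complement of \<open>X \<union> O \<union> O\<^sub>2\<close> only through \<open>O\<^sub>2\<close>, so minimality of \<open>\<kappa>\<close> gives
  \<open>|O| \<ge> \<kappa>\<close> and, apart from one configuration that is settled by hand (\<open>ample_if_rest_adjacent\<close>),
  \<open>|O\<^sub>2| \<ge> \<kappa>\<close>: thus \<open>x\<close> is Sullivan-2. If both sets have more than \<open>\<kappa>\<close> elements, there is a surplus
  of two. If one of them has exactly \<open>\<kappa>\<close> elements, the corresponding complement is a set like \<open>X\<close>
  disjoint from \<open>X\<close>, and it contains a second Sullivan-2 vertex.
\<close>

section \<open>Kings and scores in tournaments\<close>

locale oriented_graph =
  fixes V :: "'a set" and E :: "'a \<Rightarrow> 'a \<Rightarrow> bool"
  assumes finite_V: "finite V"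
    and E_in_V: "E u v \<Longrightarrow> u \<in> V \<and> v \<in> V"
    and asym: "E u v \<Longrightarrow> \<not> E v u"
begin

definition Out :: "'a \<Rightarrow> 'a set" where "Out x = {y. E x y}"

definition In :: "'a \<Rightarrow> 'a set" where "In x = {y. E y x}"

definition reach :: "'a \<Rightarrow> 'a set" where "reach x = Out x \<union> (\<Union>u\<in>Out x. Out u)"

definition tournament_on :: "'a set \<Rightarrow> bool" where
  "tournament_on T \<longleftrightarrow> T \<subseteq> V \<and> (\<forall>u\<in>T. \<forall>v\<in>T. u \<noteq> v \<longrightarrow> E u v \<or> E v u)"

definition king :: "'a set \<Rightarrow> 'a \<Rightarrow> bool" where
  "king T k \<longleftrightarrow> k \<in> T \<and> (\<forall>t\<in>T. t = k \<or> E k t \<or> (\<exists>m\<in>T. E k m \<and> E m t))"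

definition top_scorer :: "'a set \<Rightarrow> 'a \<Rightarrow> bool" where
  "top_scorer T k \<longleftrightarrow> k \<in> T \<and> (\<forall>t\<in>T. card (Out t \<inter> T) \<le> card (Out k \<inter> T))"

lemma irrefl: "\<not> E x x"
  using asym by blast

lemma Out_In_disjoint: "Out x \<inter> In x = {}"
proof (rule equals0I)
  fix t assume "t \<in> Out x \<inter> In x"
  then have "E x t" "E t x" by (simp_all add: Out_def In_def)
  then show False using asym by blast
qed

lemma not_in_Out [simp]: "x \<notin> Out x" and not_in_In [simp]: "x \<notin> In x"
  using irrefl by (simp_all add: Out_def In_def)

lemma Out_subset: "Out x \<subseteq> V"
  unfolding Out_def using E_in_V by blast

lemma In_subset: "In x \<subseteq> V"
  unfolding In_def using E_in_V by blast

lemma reach_subset: "reach x \<subseteq> V"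
  unfolding reach_def using Out_subset by blast

lemma finite_Out [simp]: "finite (Out x)"
  by (rule finite_subset[OF Out_subset finite_V])

lemma finite_In [simp]: "finite (In x)"
  by (rule finite_subset[OF In_subset finite_V])

lemma finite_reach [simp]: "finite (reach x)"
  by (rule finite_subset[OF reach_subset finite_V])

lemma Out_subset_reach: "Out x \<subseteq> reach x"
  unfolding reach_def by (rule Un_upper1)

lemma king_mem: "king T k \<Longrightarrow> k \<in> T"
  unfolding king_def by (rule conjunct1)

lemma not_in_reach: "x \<notin> reach x"
  using asym irrefl unfolding reach_def Out_def by blast

lemma tournament_finite: "tournament_on T \<Longrightarrow> finite T"
  unfolding tournament_on_def by (blast intro: finite_subset[OF _ finite_V])

lemma top_scorer_exists: 
  assumes "tournament_on T" "T \<noteq> {}" obtains k where "top_scorer T k"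
proof -
  let ?f = "\<lambda>t. card (Out t \<inter> T)"
  have fin: "finite (?f ` T)" using tournament_finite[OF assms(1)] by blast
  then obtain k where k: "k \<in> T" "Max (?f ` T) = ?f k" using assms(2) Max_in[OF fin] by blast
  have "\<forall>t\<in>T. ?f t \<le> ?f k" using Max_ge[OF fin] k(2) by (metis imageI)
  then show ?thesis using that k(1) by (simp add: top_scorer_def)
qed

text \<open>
  A vertex \<open>t\<close> that \<open>k\<close> does not reach in two steps beats \<open>k\<close> and everything that \<open>k\<close> beats, so its
  score is larger.
\<close>

lemma top_scorer_king:
  assumes T: "tournament_on T" and k: "top_scorer T k"
  shows "king T k"
proof (rule ccontr)
  assume "\<not> king T k"
  then obtain t where t: "t \<in> T" "t \<noteq> k" "\<not> E k t" "\<forall>m\<in>T. E k m \<longrightarrow> \<not> E m t"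
    using k by (auto simp: king_def top_scorer_def)
  have kT: "k \<in> T" using k by (simp add: top_scorer_def)
  have adj: "\<And>u v. u \<in> T \<Longrightarrow> v \<in> T \<Longrightarrow> u \<noteq> v \<Longrightarrow> E u v \<or> E v u"
    using T by (auto simp: tournament_on_def)
  have "E t k" using adj[OF t(1) kT t(2)] t(3) by blast
  have "Out k \<inter> T \<subseteq> Out t \<inter> T"
  proof
    fix m assume m: "m \<in> Out k \<inter> T"
    then have "m \<noteq> t" using t(3) by (auto simp: Out_def)
    then show "m \<in> Out t \<inter> T" using adj[of t m] t m by (auto simp: Out_def)
  qed
  moreover have "k \<in> Out t \<inter> T" "k \<notin> Out k \<inter> T"
    using \<open>E t k\<close> kT irrefl unfolding Out_def by blast+
  ultimately have "Out k \<inter> T \<subset> Out t \<inter> T" by blast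
  then have "card (Out k \<inter> T) < card (Out t \<inter> T)"
    by (intro psubset_card_mono) auto
  then show False using k t(1) by (auto simp: top_scorer_def)
qed

lemma king_exists:
  assumes "tournament_on T" "T \<noteq> {}" obtains k where "king T k"
  using top_scorer_exists[OF assms] top_scorer_king[OF assms(1)] by metis

lemma score_split:
  assumes T: "tournament_on T" and k: "k \<in> T"
  shows "card (Out k \<inter> T) + card (In k \<inter> T) + 1 = card T"
proof -
  have "T = (Out k \<inter> T) \<union> (In k \<inter> T) \<union> {k}"
    using T k by (auto simp: tournament_on_def Out_def In_def)
  moreover have "card ((Out k \<inter> T) \<union> (In k \<inter> T)) = card (Out k \<inter> T) + card (In k \<inter> T)"
    by (rule card_Un_disjoint) (use Out_In_disjoint in auto)
  moreover have "k \<notin> (Out k \<inter> T) \<union> (In k \<inter> T)"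
    by simp
  ultimately show ?thesis
    by (metis (no_types, lifting) Un_insert_right Suc_eq_plus1 card_insert_disjoint finite_In
        finite_Int finite_Out finite_Un sup_bot_right)
qed

lemma score_sum:
  assumes "finite T"
  shows "(\<Sum>k\<in>T. card (Out k \<inter> T)) = (\<Sum>k\<in>T. card (In k \<inter> T))"
proof -
  have o: "card (Out k \<inter> T) = (\<Sum>t\<in>T. if E k t then 1 else 0)" for k
    using assms by (simp add: sum.If_cases Out_def Int_commute Collect_conj_eq)
  have i: "card (In k \<inter> T) = (\<Sum>t\<in>T. if E t k then 1 else 0)" for k
    using assms by (simp add: sum.If_cases In_def Int_commute Collect_conj_eq)
  show ?thesis unfolding o i by (rule sum.swap)
qed

text \<open>
  Otherwise every vertex would lose more often than it wins, against the equality of the sums of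
  out-degrees and in-degrees.
\<close>

lemma top_scorer_In:
  assumes T: "tournament_on T" and k: "top_scorer T k"
  shows "2 * card (In k \<inter> T) + 1 \<le> card T"
proof (rule ccontr)
  assume neg: "\<not> ?thesis"
  have kT: "k \<in> T" using k by (simp add: top_scorer_def)
  have "card (Out t \<inter> T) < card (In t \<inter> T)" if t: "t \<in> T" for t
    using score_split[OF T t] score_split[OF T kT] k t neg by (auto simp: top_scorer_def)
  then have "(\<Sum>t\<in>T. card (Out t \<inter> T)) < (\<Sum>t\<in>T. card (In t \<inter> T))"
    using kT tournament_finite[OF T] by (intro sum_strict_mono) auto
  then show False using score_sum[OF tournament_finite[OF T]] by simp
qed

text \<open>
  If the top scorer \<open>k\<close> is unique, all others win less often than they lose unless \<open>k\<close> has a lead of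
  at least two wins over losses; a lead of one would have to balance \<open>card T - 1 \<ge> 2\<close> negative
  contributions. Tournaments with one or two vertices, for which this fails, have a source.
\<close>

lemma two_top_scorers_or_lead:
  assumes T: "tournament_on T" and ne: "T \<noteq> {}" and no_source: "\<And>k. k \<in> T \<Longrightarrow> In k \<inter> T \<noteq> {}"
  shows "(\<exists>k l. k \<noteq> l \<and> top_scorer T k \<and> top_scorer T l) \<or>
    (\<exists>k. top_scorer T k \<and> 2 * card (In k \<inter> T) + 3 \<le> card T)"
proof (rule ccontr)
  assume neg: "\<not> ?thesis"
  obtain k where k: "top_scorer T k" using top_scorer_exists[OF T ne] .
  have kT: "k \<in> T" using k by (simp add: top_scorer_def)
  have fin: "finite T" by (rule tournament_finite[OF T])
  have low: "card (Out t \<inter> T) + 1 \<le> card (Out k \<inter> T)" if t: "t \<in> T" "t \<noteq> k" for t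
  proof (rule ccontr)
    assume "\<not> ?thesis"
    then have "top_scorer T t" using k t by (fastforce simp: top_scorer_def)
    then show False using neg k t by blast
  qed
  have kk: "\<not> 2 * card (In k \<inter> T) + 3 \<le> card T" using neg k by blast
  have "card (Out t \<inter> T) + 1 \<le> card (In t \<inter> T)" if t: "t \<in> T - {k}" for t
    using score_split[OF T, of t] score_split[OF T kT] low[of t] kk t by auto
  then have "(\<Sum>t\<in>T-{k}. card (Out t \<inter> T) + 1) \<le> (\<Sum>t\<in>T-{k}. card (In t \<inter> T))"
    by (rule sum_mono)
  then have "(\<Sum>t\<in>T-{k}. card (Out t \<inter> T)) + card (T - {k}) \<le> (\<Sum>t\<in>T-{k}. card (In t \<inter> T))"
    by (simp only: sum.distrib sum_constant) simp
  moreover have "(\<Sum>t\<in>T. card (Out t \<inter> T)) = card (Out k \<inter> T) + (\<Sum>t\<in>T-{k}. card (Out t \<inter> T))"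
    "(\<Sum>t\<in>T. card (In t \<inter> T)) = card (In k \<inter> T) + (\<Sum>t\<in>T-{k}. card (In t \<inter> T))"
    using fin kT by (auto intro: sum.remove)
  ultimately have "card (In k \<inter> T) + card (T - {k}) \<le> card (Out k \<inter> T)"
    using score_sum[OF fin] by linarith
  then have le2: "card T \<le> 2"
    using kk score_split[OF T kT] fin kT by (simp add: card_Diff_singleton)
  obtain a where a: "a \<in> T" "E a k" using no_source[OF kT] by (auto simp: In_def)
  obtain b where b: "b \<in> T" "E b a" using no_source[OF a(1)] by (auto simp: In_def)
  have "b \<noteq> k" "a \<noteq> k" "b \<noteq> a" using a b asym irrefl by blast+
  then have "card {k, a, b} = 3" by auto
  moreover have "card {k, a, b} \<le> card T" using a b kT fin by (intro card_mono) auto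
  ultimately show False using le2 by linarith
qed

end

section \<open>Sullivan-1 vertices of strong local tournaments\<close>

text \<open>
  Strong connectivity is stated without paths: every nonempty set closed under in-neighbours is
  everything. All later uses of connectivity are of this form.
\<close>

locale strong_local_tournament = oriented_graph +
  assumes out_adj: "E u v \<Longrightarrow> E u w \<Longrightarrow> v \<noteq> w \<Longrightarrow> E v w \<or> E w v"
    and in_adj: "E v u \<Longrightarrow> E w u \<Longrightarrow> v \<noteq> w \<Longrightarrow> E v w \<or> E w v"
    and strong: "C \<subseteq> V \<Longrightarrow> C \<noteq> {} \<Longrightarrow> (\<And>u v. E u v \<Longrightarrow> v \<in> C \<Longrightarrow> u \<in> C) \<Longrightarrow> C = V"
begin

lemma tournament_Out:
  assumes "T \<subseteq> Out x"
  shows "tournament_on T"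
  unfolding tournament_on_def
proof (intro conjI ballI impI)
  show "T \<subseteq> V" using assms Out_subset by blast
  fix u v assume "u \<in> T" "v \<in> T" "u \<noteq> v"
  moreover from this have "E x u" "E x v" using assms by (auto simp: Out_def)
  ultimately show "E u v \<or> E v u" by (intro out_adj)
qed

lemma tournament_In:
  assumes "T \<subseteq> In x"
  shows "tournament_on T"
  unfolding tournament_on_def
proof (intro conjI ballI impI)
  show "T \<subseteq> V" using assms In_subset by blast
  fix u v assume "u \<in> T" "v \<in> T" "u \<noteq> v"
  moreover from this have "E u x" "E v x" using assms by (auto simp: In_def)
  ultimately show "E u v \<or> E v u" by (intro in_adj)
qed

lemma strong_out:
  assumes "C \<subseteq> V" "C \<noteq> {}" "\<And>u v. E u v \<Longrightarrow> u \<in> C \<Longrightarrow> v \<in> C"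
  shows "C = V"
proof (rule ccontr)
  assume "C \<noteq> V"
  have "V - C = V"
  proof (rule strong)
    show "V - C \<noteq> {}" using \<open>C \<noteq> V\<close> assms(1) by blast
    show "u \<in> V - C" if "E u v" "v \<in> V - C" for u v
      using that assms(3)[of u v] E_in_V[of u v] by blast
  qed blast
  then show False using assms(1,2) by blast
qed

lemma In_nonempty:
  assumes "x \<in> V" "V \<noteq> {x}"
  shows "In x \<noteq> {}"
proof
  assume "In x = {}"
  then have "\<not> E u x" for u by (auto simp: In_def)
  then have "{x} = V" using assms(1) by (intro strong) auto
  then show False using assms by blast
qed

definition sullivan1 :: "'a \<Rightarrow> bool" where
  "sullivan1 x \<longleftrightarrow> x \<in> V \<and> card (Out x) + card (In x) \<le> card (reach x)"

definition sullivan2 :: "'a \<Rightarrow> bool" where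
  "sullivan2 x \<longleftrightarrow> x \<in> V \<and> 2 * card (In x) \<le> card (reach x)"

lemma king_of_In_reaches:
  assumes "king T u" "T \<subseteq> In x"
  shows "(T - {u}) \<union> {x} \<union> Out x \<subseteq> reach u"
proof
  fix t assume t: "t \<in> (T - {u}) \<union> {x} \<union> Out x"
  have ux: "E u x" using assms by (auto simp: king_def In_def)
  from t consider "t \<in> T" "t \<noteq> u" | "t = x" | "E x t" by (auto simp: Out_def)
  then show "t \<in> reach u"
  proof cases
    case 1
    then have "E u t \<or> (\<exists>m. E u m \<and> E m t)" using assms(1) unfolding king_def by blast
    then show ?thesis unfolding reach_def Out_def by blast
  qed (use ux in \<open>auto simp: reach_def Out_def\<close>)
qed

lemma card_nbrs:
  assumes "T \<subseteq> In x" "u \<in> T"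
  shows "card ((T - {u}) \<union> {x} \<union> Out x) = card T + card (Out x)"
proof -
  have fin: "finite T" by (rule finite_subset[OF assms(1) finite_In])
  have "card ((T - {u}) \<union> {x} \<union> Out x) = card ((T - {u}) \<union> {x}) + card (Out x)"
  proof (rule card_Un_disjoint)
    show "((T - {u}) \<union> {x}) \<inter> Out x = {}"
      using Out_In_disjoint[of x] not_in_Out[of x] assms(1) by blast
  qed (use fin in simp_all)
  moreover have "x \<notin> T - {u}" using assms(1) not_in_In[of x] by blast
  then have "card ((T - {u}) \<union> {x}) = Suc (card (T - {u}))" using fin by simp
  moreover have "Suc (card (T - {u})) = card T" by (rule card_Suc_Diff1[OF fin assms(2)])
  ultimately show ?thesis by linarith
qed

text \<open>
  This inequality is the source of all Sullivan-1 vertices.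
\<close>

lemma reach_king_of_In:
  assumes "king (In x) u"
  shows "card (Out x) + card (In x) \<le> card (reach u)"
proof -
  have "card (Out x) + card (In x) = card ((In x - {u}) \<union> {x} \<union> Out x)"
    using card_nbrs[OF order_refl king_mem[OF assms]] by linarith
  also have "\<dots> \<le> card (reach u)"
    by (rule card_mono[OF finite_reach king_of_In_reaches[OF assms order_refl]])
  finally show ?thesis .
qed

lemma sullivan1_max_reach:
  assumes x: "x \<in> V" and max: "\<And>y. y \<in> V \<Longrightarrow> card (reach y) \<le> card (reach x)"
  shows "sullivan1 x"
proof (cases "In x = {}")
  case True
  moreover have "card (Out x) \<le> card (reach x)"
    by (rule card_mono[OF finite_reach Out_subset_reach])
  ultimately have "card (Out x) + card (In x) \<le> card (reach x)" by simp
  then show ?thesis using x by (simp add: sullivan1_def)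
next
  case False
  obtain u where u: "king (In x) u" by (rule king_exists[OF tournament_In[OF order_refl] False])
  have "u \<in> V" using king_mem[OF u] In_subset by blast
  then show ?thesis using reach_king_of_In[OF u] max[of u] x by (simp add: sullivan1_def)
qed

lemma sullivan1_exists:
  assumes "V \<noteq> {}" obtains x where "sullivan1 x"
proof -
  let ?f = "\<lambda>t. card (reach t)"
  have fin: "finite (?f ` V)" using finite_V by blast
  then obtain x where x: "x \<in> V" "Max (?f ` V) = ?f x" using assms Max_in[OF fin] by blast
  have "card (reach y) \<le> card (reach x)" if "y \<in> V" for y
    using Max_ge[OF fin, of "?f y"] x(2) that by simp
  from sullivan1_max_reach[OF x(1) this] show ?thesis by (rule that)
qed

text \<open>
  Suppose that \<open>x\<close> is the only such vertex, and let \<open>Y\<close> be the set of vertices with the second largest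
  value \<open>\<rho>\<close> of \<open>card (reach y)\<close>. By \<open>reach_king_of_In\<close> a king of \<open>In y\<close> can only be \<open>x\<close>, which therefore
  dominates the rest of \<open>In y\<close>. A king \<open>u\<close> of that rest almost satisfies the same inequality; it
  must belong to \<open>Y\<close> again, and \<open>reach u\<close> is determined exactly. Applied to a king \<open>k\<close> of the
  tournament \<open>Y\<close>, this yields a \<open>u\<close> that is adjacent to everything it reaches, so that no arc leaves
  \<open>insert u (reach u)\<close>; but \<open>x\<close> is outside.
\<close>

lemma two_sullivan1:
  assumes V1: "card V > 1"
  shows "\<exists>x y. x \<noteq> y \<and> sullivan1 x \<and> sullivan1 y"
proof (rule ccontr)
  assume neg: "\<not> ?thesis"
  have "V \<noteq> {}" using V1 by auto
  then obtain x where x: "sullivan1 x" by (rule sullivan1_exists)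
  have xV: "x \<in> V" using x by (simp add: sullivan1_def)
  have only: "y = x" if "sullivan1 y" for y using neg x that by blast
  define W where "W = V - {x}"
  have "V \<noteq> {x}" using V1 by auto
  then have "W \<noteq> {}" using xV unfolding W_def by blast
  have finW: "finite ((\<lambda>t. card (reach t)) ` W)" using finite_V by (simp add: W_def)
  define \<rho> where "\<rho> = Max ((\<lambda>t. card (reach t)) ` W)"
  define Y where "Y = {y \<in> W. card (reach y) = \<rho>}"
  have le: "card (reach t) \<le> \<rho>" if "t \<in> W" for t
    unfolding \<rho>_def using that by (intro Max_ge[OF finW]) blast
  have "\<rho> \<in> (\<lambda>t. card (reach t)) ` W"
    unfolding \<rho>_def using Max_in[OF finW] \<open>W \<noteq> {}\<close> by blast
  then have Yne: "Y \<noteq> {}" by (auto simp: Y_def)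
  have YD: "y \<in> V" "y \<noteq> x" "card (reach y) = \<rho>" if "y \<in> Y" for y
    using that by (auto simp: Y_def W_def)
  have small: "\<rho> < card (Out y) + card (In y)" if "y \<in> Y" for y
  proof -
    have "\<not> sullivan1 y" using only[of y] YD(2)[OF that] by blast
    then show ?thesis using YD(1,3)[OF that] by (simp add: sullivan1_def)
  qed
  \<comment> \<open>any other king of \<open>In y\<close> would have a value above the second largest one\<close>
  have king_x: "u = x" if "y \<in> Y" "king (In y) u" for y u
  proof (rule ccontr)
    assume "u \<noteq> x"
    then have "u \<in> W" using king_mem[OF that(2)] In_subset unfolding W_def by blast
    then show False using le[of u] small[OF that(1)] reach_king_of_In[OF that(2)] by linarith
  qed
  have x_to: "E x y" if "y \<in> Y" for y
  proof -
    have "V \<noteq> {y}" using V1 by auto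
    then have "In y \<noteq> {}" using In_nonempty YD[OF that] by blast
    then obtain u where u: "king (In y) u" by (rule king_exists[OF tournament_In[OF order_refl]])
    then have "u = x" using king_x[OF that] by blast
    then show ?thesis using king_mem[OF u] by (simp add: In_def)
  qed
  have x_source: "E x z" if "y \<in> Y" "E z y" "z \<noteq> x" for y z
  proof (rule ccontr)
    assume "\<not> E x z"
    then have "E z x" using in_adj[of z y x] that x_to by blast
    \<comment> \<open>a king among the vertices of \<open>In y\<close> that beat \<open>x\<close> is a king of all of \<open>In y\<close>\<close>
    define T where "T = In y \<inter> In x"
    have "z \<in> T" using that \<open>E z x\<close> by (simp add: T_def In_def)
    have "tournament_on T" by (rule tournament_In[of T y]) (simp add: T_def)
    then obtain k where k: "king T k" by (rule king_exists) (use \<open>z \<in> T\<close> in blast)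
    have "king (In y) k"
      unfolding king_def
    proof (intro conjI ballI)
      show "k \<in> In y" using king_mem[OF k] by (simp add: T_def)
      fix t assume t: "t \<in> In y"
      have "E k x" "x \<in> In y" using king_mem[OF k] x_to[OF that(1)] by (simp_all add: T_def In_def)
      show "t = k \<or> E k t \<or> (\<exists>m\<in>In y. E k m \<and> E m t)"
      proof (cases "t = x \<or> E x t")
        case True then show ?thesis using \<open>E k x\<close> \<open>x \<in> In y\<close> by blast
      next
        case False
        then have "E t x" using in_adj[of t y x] t x_to[OF that(1)] by (auto simp: In_def)
        then have "t \<in> T" using t by (simp add: T_def In_def)
        then have "t = k \<or> E k t \<or> (\<exists>m\<in>T. E k m \<and> E m t)" using k unfolding king_def by blast
        then show ?thesis unfolding T_def by blast
      qed
    qed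
    then have "k = x" using king_x that(1) by blast
    then show False using king_mem[OF k] irrefl by (simp add: T_def In_def)
  qed
  \<comment> \<open>the lower bound for \<open>reach u\<close> is one less than the degree of \<open>y\<close>, hence at least \<open>\<rho>\<close>: so it is attained\<close>
  have step: "\<exists>u\<in>Y. E u y \<and> reach u = (In y - {x} - {u}) \<union> {y} \<union> Out y
      \<and> \<rho> + 1 = card (Out y) + card (In y)" if y: "y \<in> Y" for y
  proof -
    have xy: "E x y" by (rule x_to[OF y])
    define Q where "Q = In y - {x}"
    have cQ: "card (In y) = card Q + 1"
      using card_Suc_Diff1[OF finite_In, of x y] xy by (simp add: Q_def In_def)
    have "Q \<noteq> {}"
    proof
      assume "Q = {}"
      then have "\<rho> \<le> card (Out y)" using small[OF y] cQ by simp
      then have "Out y = reach y"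
        using YD(3)[OF y] by (intro card_seteq[OF finite_reach Out_subset_reach]) simp
      then have "E p v \<Longrightarrow> p \<in> insert y (Out y) \<Longrightarrow> v \<in> insert y (Out y)" for p v
        unfolding reach_def Out_def by blast
      then have "insert y (Out y) = V"
        using YD(1)[OF y] Out_subset[of y] by (intro strong_out) blast+
      then show False using xV YD(2)[OF y] asym[OF xy] by (auto simp: Out_def)
    qed
    moreover have "tournament_on Q" by (rule tournament_In[of Q y]) (auto simp: Q_def)
    ultimately obtain u where u: "king Q u" using king_exists by metis
    have uQ: "u \<in> Q" by (rule king_mem[OF u])
    have uW: "u \<in> W" using uQ In_subset unfolding Q_def W_def by blast
    have QIn: "Q \<subseteq> In y" by (auto simp: Q_def)
    note R = king_of_In_reaches[OF u QIn] and c = card_nbrs[OF QIn uQ]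
    have "card (reach u) \<le> card Q + card (Out y)" "card Q + card (Out y) \<le> card (reach u)"
      using le[OF uW] small[OF y] cQ card_mono[OF finite_reach R] c by linarith+
    then have "reach u = (Q - {u}) \<union> {y} \<union> Out y"
      using card_seteq[OF finite_reach R] c by simp
    moreover have "card (reach u) = \<rho>"
      using le[OF uW] small[OF y] cQ card_mono[OF finite_reach R] c by linarith
    moreover have "\<rho> + 1 = card (Out y) + card (In y)"
      using calculation(2) le[OF uW] small[OF y] cQ card_mono[OF finite_reach R] c by linarith
    ultimately show ?thesis using uQ uW by (auto simp: Y_def Q_def In_def)
  qed
  have "tournament_on Y" using x_to by (intro tournament_Out[of _ x]) (auto simp: Out_def)
  then obtain k where k: "king Y k" using Yne by (rule king_exists)
  have kY: "k \<in> Y" by (rule king_mem[OF k])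
  obtain u where u: "u \<in> Y" "E u k" "reach u = (In k - {x} - {u}) \<union> {k} \<union> Out k"
    using step[OF kY] by blast
  have "x \<notin> reach u" using u(3) YD(2)[OF kY] asym[OF x_to[OF kY]] by (simp add: Out_def)
  have "\<not> E k u" "u \<noteq> k" using u(2) asym irrefl by blast+
  then obtain b where b: "b \<in> Y" "E k b" "E b u"
    using k u(1) unfolding king_def by blast
  \<comment> \<open>a nonneighbour \<open>w\<close> of \<open>u\<close> would be dominated by \<open>k\<close>, then by \<open>b\<close>, which also dominates \<open>u\<close>\<close>
  have adj: "E u w \<or> E w u" if w: "w \<in> reach u" for w
  proof (rule ccontr)
    assume na: "\<not> ?thesis"
    have "w \<noteq> u" using w not_in_reach by blast
    have "w \<noteq> x" using w \<open>x \<notin> reach u\<close> by blast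
    have "w \<notin> In k" using in_adj[of w k u] u(2) \<open>w \<noteq> u\<close> na by (auto simp: In_def)
    moreover have "w \<noteq> k" using na u(2) by blast
    ultimately have kw: "E k w" using w u(3) by (auto simp: Out_def)
    have "w \<noteq> b" using na b(3) by blast
    then have "E w b \<or> E b w" using out_adj[OF kw b(2)] by blast
    moreover have "\<not> E b w" using out_adj[OF b(3), of w] na \<open>w \<noteq> u\<close> by blast
    ultimately have "E x w" using x_source[OF b(1)] \<open>w \<noteq> x\<close> by blast
    then show False using out_adj[OF x_to[OF u(1)], of w] na \<open>w \<noteq> u\<close> by blast
  qed
  have sub: "reach u \<subseteq> Out u \<union> (In u - {x})"
    using adj \<open>x \<notin> reach u\<close> by (auto simp: Out_def In_def)
  have "card (Out u \<union> (In u - {x})) = card (Out u) + card (In u - {x})"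
    by (rule card_Un_disjoint) (use Out_In_disjoint in auto)
  moreover have "card (In u - {x}) + 1 = card (In u)"
    using card_Suc_Diff1[OF finite_In, of x u] x_to[OF u(1)] by (simp add: In_def)
  ultimately have R: "reach u = Out u \<union> (In u - {x})"
    using step[OF u(1)] YD(3)[OF u(1)] sub by (intro card_subset_eq) auto
  have "insert u (reach u) = V"
  proof (rule strong_out)
    show "insert u (reach u) \<subseteq> V" using YD(1)[OF u(1)] reach_subset by blast
    fix p v assume pv: "E p v" and p: "p \<in> insert u (reach u)"
    show "v \<in> insert u (reach u)"
    proof (rule ccontr)
      assume v: "v \<notin> insert u (reach u)"
      have "p \<noteq> u" using pv v by (auto simp: reach_def Out_def)
      then have pr: "p \<in> reach u" using p by blast
      moreover have "\<not> E u p" using pv v by (auto simp: reach_def Out_def)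
      ultimately have pu: "E p u" using adj by blast
      have "\<not> E u v" using v by (auto simp: reach_def Out_def)
      then have "E v u" using out_adj[OF pv pu] v by blast
      then have "v = x" using v R by (auto simp: In_def)
      have "p \<noteq> x" using pr \<open>x \<notin> reach u\<close> by blast
      then show False using x_source[OF u(1) pu] pv \<open>v = x\<close> asym by blast
    qed
  qed simp
  then show False using xV YD(2)[OF u(1)] \<open>x \<notin> reach u\<close> by auto
qed

text \<open>
  The alternative of part (c): two vertices, or one with a surplus of two.
\<close>

definition ample :: bool where
  "ample \<longleftrightarrow> (\<exists>x y. x \<noteq> y \<and> sullivan2 x \<and> sullivan2 y) \<or> (\<exists>x\<in>V. 2 * card (In x) + 2 \<le> card (reach x))"

lemma ample_imp_sullivan2: "ample \<Longrightarrow> \<exists>x. sullivan2 x"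
  unfolding ample_def sullivan2_def by force

lemma reach_king_of_V:
  assumes "king V k" shows "card (reach k) + 1 = card V"
proof -
  have k: "k \<in> V" by (rule king_mem[OF assms])
  have "V - {k} \<subseteq> reach k"
  proof
    fix t assume "t \<in> V - {k}"
    then have "E k t \<or> (\<exists>m\<in>V. E k m \<and> E m t)" using assms unfolding king_def by blast
    then show "t \<in> reach k" unfolding reach_def Out_def by blast
  qed
  then have "reach k = V - {k}" using reach_subset not_in_reach by blast
  then show ?thesis using card_Suc_Diff1[OF finite_V k] by simp
qed

lemma In_Int_V [simp]: "In k \<inter> V = In k"
  using In_subset by blast

lemma sullivan2_top_scorer:
  assumes "tournament_on V" "top_scorer V k"
  shows "sullivan2 k"
proof -
  have K: "king V k" by (rule top_scorer_king[OF assms])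
  have "2 * card (In k) + 1 \<le> card V" using top_scorer_In[OF assms] by simp
  then show ?thesis using reach_king_of_V[OF K] king_mem[OF K] by (simp add: sullivan2_def)
qed

lemma ample_tournament:
  assumes T: "tournament_on V" and V1: "card V > 1"
  shows ample
proof -
  have ne: "V \<noteq> {}" using V1 by auto
  have src: "In k \<inter> V \<noteq> {}" if "k \<in> V" for k
  proof -
    have "V \<noteq> {k}" using V1 by auto
    then show ?thesis using In_nonempty[OF that] by simp
  qed
  consider k l where "k \<noteq> l" "top_scorer V k" "top_scorer V l"
    | k where "top_scorer V k" "2 * card (In k \<inter> V) + 3 \<le> card V"
    using two_top_scorers_or_lead[OF T ne src] by blast
  then show ?thesis
  proof cases
    case 1
    then show ?thesis unfolding ample_def using sullivan2_top_scorer[OF T] by blast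
  next
    case 2
    have K: "king V k" by (rule top_scorer_king[OF T 2(1)])
    have "2 * card (In k) + 2 \<le> card (reach k)" using 2(2) reach_king_of_V[OF K] by simp
    then show ?thesis unfolding ample_def using king_mem[OF K] by blast
  qed
qed

section \<open>Minimum separations and Sullivan-2 vertices\<close>

text \<open>
  \<open>entry X\<close> separates \<open>X\<close> from the remaining vertices on the in-side. \<open>separated X\<close> excludes trivial
  separations by asking for a remaining vertex that is not adjacent to some vertex of \<open>X\<close>: the
  arc from \<open>y\<close> to \<open>x\<close> is ruled out by \<open>y \<notin> entry X\<close>.
\<close>

definition entry :: "'a set \<Rightarrow> 'a set" where
  "entry X = {s. s \<notin> X \<and> (\<exists>x\<in>X. E s x)}"

definition separated :: "'a set \<Rightarrow> bool" where
  "separated X \<longleftrightarrow> X \<subseteq> V \<and> (\<exists>x\<in>X. \<exists>y\<in>V. y \<notin> X \<and> y \<notin> entry X \<and> \<not> E x y)"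

definition min_separated :: "'a set \<Rightarrow> bool" where
  "min_separated X \<longleftrightarrow> separated X \<and> (\<forall>Y. separated Y \<longrightarrow> card (entry X) \<le> card (entry Y))"

definition atom :: "'a set \<Rightarrow> bool" where
  "atom X \<longleftrightarrow> min_separated X \<and> (\<forall>Y. Y \<subset> X \<longrightarrow> \<not> min_separated Y)"

lemma entry_subset: "entry X \<subseteq> V"
  unfolding entry_def using E_in_V by blast

lemma finite_entry [simp]: "finite (entry X)"
  by (rule finite_subset[OF entry_subset finite_V])

lemma separatedI:
  assumes "X \<subseteq> V" "x \<in> X" "y \<in> V" "y \<notin> X" "y \<notin> entry X" "\<not> E x y"
  shows "separated X"
  unfolding separated_def using assms by blast

lemma min_separatedI:
  assumes "min_separated X" "separated Y" "card (entry Y) \<le> card (entry X)"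
  shows "min_separated Y"
  using assms unfolding min_separated_def by (meson le_trans)

lemma min_separated_exists:
  assumes "x \<in> V" "y \<in> V" "x \<noteq> y" "\<not> E x y" "\<not> E y x"
  shows "\<exists>X. min_separated X"
proof -
  have "separated {x}" using assms by (intro separatedI[of _ x y]) (auto simp: entry_def)
  from ex_has_least_nat[of separated, OF this, of "\<lambda>X. card (entry X)"]
  show ?thesis unfolding min_separated_def by blast
qed

lemma atom_exists:
  assumes "min_separated X" shows "\<exists>Y\<subseteq>X. atom Y"
proof -
  have "X \<subseteq> V" using assms unfolding min_separated_def separated_def by blast
  then have "finite X" by (rule finite_subset[OF _ finite_V])
  then show ?thesis using assms
  proof (induction X rule: finite_psubset_induct)
    case (psubset X)
    show ?case
    proof (cases "atom X")
      case False
      then obtain Y where "Y \<subset> X" "min_separated Y" using psubset.prems unfolding atom_def by blast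
      then show ?thesis using psubset.IH[of Y] by blast
    qed blast
  qed
qed

end

locale separation_atom = strong_local_tournament +
  fixes X
  assumes atom_X: "atom X"
begin

lemma min_X: "min_separated X"
  using atom_X unfolding atom_def by blast

lemma entry_le: "separated Y \<Longrightarrow> card (entry X) \<le> card (entry Y)"
  using min_X unfolding min_separated_def by blast

lemma X_subset: "X \<subseteq> V"
  using min_X unfolding min_separated_def separated_def by blast

lemma finite_X [simp]: "finite X"
  by (rule finite_subset[OF X_subset finite_V])

text \<open>
  A smaller set that is closed under in-neighbours within \<open>X\<close> has no further entries, so it would
  be a smaller minimum separated set.
\<close>

lemma in_closed_far:
  assumes Z: "Z \<subseteq> X" "\<And>u v. u \<in> X \<Longrightarrow> v \<in> Z \<Longrightarrow> E u v \<Longrightarrow> u \<in> Z"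
    and z: "z \<in> Z" and y: "y \<in> V" "y \<notin> X" "y \<notin> entry X" "\<not> E z y"
  shows "Z = X"
proof -
  have sub: "entry Z \<subseteq> entry X"
  proof
    fix s assume "s \<in> entry Z"
    then obtain v where v: "s \<notin> Z" "v \<in> Z" "E s v" unfolding entry_def by blast
    then have "s \<notin> X" using Z(2)[of s v] by blast
    then show "s \<in> entry X" using v(2,3) Z(1) unfolding entry_def by blast
  qed
  have "separated Z"
  proof (rule separatedI[OF _ z y(1) _ _ y(4)])
    show "Z \<subseteq> V" using Z(1) X_subset by (rule subset_trans)
    show "y \<notin> Z" using Z(1) y(2) by (rule contra_subsetD)
    show "y \<notin> entry Z" using sub y(3) by (rule contra_subsetD)
  qed
  then have "min_separated Z"
    by (rule min_separatedI[OF min_X]) (rule card_mono[OF finite_entry sub])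
  then show ?thesis using atom_X Z(1) unfolding atom_def by blast
qed

text \<open>
  The property of not dominating \<open>y\<close> is inherited by in-neighbours within \<open>X\<close>: if \<open>u\<close> dominates \<open>v\<close>
  and \<open>y\<close>, then \<open>v\<close> and \<open>y\<close> are adjacent, and \<open>y\<close> does not enter \<open>X\<close>. So by \<open>in_closed_far\<close> one
  nonneighbour of \<open>y\<close> in \<open>X\<close> makes all of \<open>X\<close> nonadjacent to \<open>y\<close>.
\<close>

lemma far_vertex:
  obtains y where "y \<in> V" "y \<notin> X" "y \<notin> entry X" "\<And>v. v \<in> X \<Longrightarrow> \<not> E v y" "\<And>v. v \<in> X \<Longrightarrow> \<not> E y v"
proof -
  obtain x y where x: "x \<in> X" and y: "y \<in> V" "y \<notin> X" "y \<notin> entry X" and na: "\<not> E x y"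
    using min_X unfolding min_separated_def separated_def by blast
  have yX: "\<not> E y v" if "v \<in> X" for v using y that unfolding entry_def by blast
  have "{v \<in> X. \<not> E v y} = X"
  proof (rule in_closed_far[OF _ _ _ y na])
    show "{v \<in> X. \<not> E v y} \<subseteq> X" by blast
    show "x \<in> {v \<in> X. \<not> E v y}" using x na by blast
    fix u v assume uv: "u \<in> X" "v \<in> {v \<in> X. \<not> E v y}" "E u v"
    have "v \<noteq> y" using uv(2) y(2) by blast
    have "\<not> E u y" using out_adj[OF uv(3) _ \<open>v \<noteq> y\<close>] uv(2) yX by blast
    then show "u \<in> {v \<in> X. \<not> E v y}" using uv(1) by blast
  qed
  then have Xy: "\<not> E v y" if "v \<in> X" for v using that by blast
  show ?thesis by (rule that[OF y Xy yX])
qed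

lemma X_nonempty: "X \<noteq> {}"
  using min_X unfolding min_separated_def separated_def by blast

text \<open>
  This is the strong connectivity of the subdigraph induced by \<open>X\<close>, in the form in which it
  is used below.
\<close>

lemma in_closed:
  assumes Z: "Z \<subseteq> X" "Z \<noteq> {}" "\<And>u v. u \<in> X \<Longrightarrow> v \<in> Z \<Longrightarrow> E u v \<Longrightarrow> u \<in> Z"
  shows "Z = X"
proof -
  obtain y where y: "y \<in> V" "y \<notin> X" "y \<notin> entry X" and no: "\<And>v. v \<in> X \<Longrightarrow> \<not> E v y"
    using far_vertex by metis
  obtain z where z: "z \<in> Z" using Z(2) by blast
  then have "z \<in> X" using Z(1) by blast
  show ?thesis by (rule in_closed_far[OF Z(1) Z(3) z y no[OF \<open>z \<in> X\<close>]])
qed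

lemma X_dominates:
  assumes v: "v \<notin> X" "v \<notin> entry X" and d: "d \<in> X" "E d v" and c: "c \<in> X"
  shows "E c v"
proof (rule ccontr)
  assume "\<not> E c v"
  have "{c \<in> X. \<not> E c v} = X"
  proof (rule in_closed)
    show "{c \<in> X. \<not> E c v} \<noteq> {}" using c \<open>\<not> E c v\<close> by blast
    fix u c assume uc: "u \<in> X" "c \<in> {c \<in> X. \<not> E c v}" "E u c"
    have "c \<noteq> v" "\<not> E v c" using uc(2) v unfolding entry_def by blast+
    then have "\<not> E u v" using out_adj[OF uc(3)] uc(2) by blast
    then show "u \<in> {c \<in> X. \<not> E c v}" using uc(1) by blast
  qed blast
  then show False using d by blast
qed

definition exits :: "'a set" where "exits = {v. v \<notin> X \<and> (\<exists>d\<in>X. E d v)}"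

lemma exits_subset: "exits \<subseteq> V"
  unfolding exits_def using E_in_V by blast

lemma finite_exits [simp]: "finite exits"
  by (rule finite_subset[OF exits_subset finite_V])

text \<open>
  Adding all out-neighbours to \<open>X\<close> creates no new entries: an in-neighbour of an exit from outside \<open>X\<close> shares an
  out-neighbour with a vertex of \<open>X\<close>, hence is adjacent to it and thus an exit or an entry
  itself. So an entry that is also an exit could be absorbed, contradicting minimality.
\<close>

lemma exits_disjoint_entry: "exits \<inter> entry X = {}"
proof (rule ccontr)
  assume mixed: "exits \<inter> entry X \<noteq> {}"
  define X' where "X' = X \<union> exits"
  obtain y where y: "y \<in> V" "y \<notin> X" "y \<notin> entry X" "\<And>v. v \<in> X \<Longrightarrow> \<not> E v y"
    using far_vertex by metis
  have sub: "entry X' \<subseteq> entry X - exits"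
  proof
    fix t assume t: "t \<in> entry X'"
    then have "t \<notin> X" "t \<notin> exits" by (auto simp: entry_def X'_def)
    obtain q where q: "q \<in> X'" "E t q" using t unfolding entry_def by blast
    have "t \<in> entry X"
    proof (cases "q \<in> X")
      case True
      then show ?thesis using q(2) \<open>t \<notin> X\<close> unfolding entry_def by blast
    next
      case False
      then obtain d where d: "d \<in> X" "E d q" using q(1) unfolding X'_def exits_def by blast
      have "t \<noteq> d" using d(1) \<open>t \<notin> X\<close> by blast
      then have "E t d \<or> E d t" by (rule in_adj[OF q(2) d(2)])
      moreover have "\<not> E d t" using d(1) \<open>t \<notin> X\<close> \<open>t \<notin> exits\<close> unfolding exits_def by blast
      ultimately show ?thesis using d(1) \<open>t \<notin> X\<close> unfolding entry_def by blast
    qed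
    then show "t \<in> entry X - exits" using \<open>t \<notin> exits\<close> by blast
  qed
  obtain x where x: "x \<in> X" using X_nonempty by blast
  have "y \<notin> X'" using y(2,4) unfolding X'_def exits_def by blast
  moreover have "X' \<subseteq> V" using X_subset exits_subset unfolding X'_def by blast
  ultimately have "separated X'"
    using x y sub by (intro separatedI[of X' x y]) (auto simp: X'_def)
  then have "card (entry X) \<le> card (entry X')" by (rule entry_le)
  also have "\<dots> \<le> card (entry X - exits)" by (rule card_mono[OF _ sub]) simp
  also have "\<dots> < card (entry X)"
    using mixed by (intro psubset_card_mono) auto
  finally show False by simp
qed

lemma X_to_exits: "d \<in> X \<Longrightarrow> v \<in> exits \<Longrightarrow> E d v"
  using X_dominates[of v] exits_disjoint_entry unfolding exits_def by blast

lemma no_arc_to_entry: "d \<in> X \<Longrightarrow> s \<in> entry X \<Longrightarrow> \<not> E d s"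
  using exits_disjoint_entry unfolding exits_def entry_def by blast

text \<open>
  Two in-neighbours of a vertex of \<open>X\<close> are adjacent and \<open>X\<close> sends no arc to an entry, so being
  dominated by a given entry is inherited by in-neighbours within \<open>X\<close>.
\<close>

lemma entry_to_X:
  assumes s: "s \<in> entry X" and d: "d \<in> X"
  shows "E s d"
proof -
  have "{v \<in> X. E s v} = X"
  proof (rule in_closed)
    show "{v \<in> X. E s v} \<noteq> {}" using s unfolding entry_def by blast
    fix u v assume uv: "u \<in> X" "v \<in> {v \<in> X. E s v}" "E u v"
    have "s \<noteq> u" using s uv(1) unfolding entry_def by blast
    then have "E s u \<or> E u s" using in_adj[OF _ uv(3)] uv(2) by blast
    then show "u \<in> {v \<in> X. E s v}" using no_arc_to_entry[OF uv(1) s] uv(1) by blast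
  qed blast
  then show ?thesis using d by blast
qed

lemma entry_nonempty: "entry X \<noteq> {}"
proof
  assume e: "entry X = {}"
  have "X = V"
  proof (rule strong[OF X_subset X_nonempty])
    fix u v assume "E u v" "v \<in> X"
    then show "u \<in> X" using e unfolding entry_def by blast
  qed
  then show False using far_vertex by metis
qed

lemma tournament_X: "tournament_on X"
proof -
  obtain s where "s \<in> entry X" using entry_nonempty by blast
  then have "X \<subseteq> Out s" using entry_to_X unfolding Out_def by blast
  then show ?thesis by (rule tournament_Out)
qed

text \<open>
  Separation is symmetric: the remaining vertices and the entries together are entered only
  through the exits.
\<close>

lemma separated_complement: "separated (V - X - exits)" and entry_complement: "entry (V - X - exits) \<subseteq> exits"
proof -
  show sub: "entry (V - X - exits) \<subseteq> exits"
  proof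
    fix t assume "t \<in> entry (V - X - exits)"
    then obtain c where c: "t \<notin> V - X - exits" "c \<in> V - X - exits" "E t c" unfolding entry_def by blast
    have "t \<notin> X" using c(2,3) unfolding exits_def by blast
    then show "t \<in> exits" using c(1) E_in_V[OF c(3)] by blast
  qed
  obtain y where y: "y \<in> V" "y \<notin> X" "y \<notin> entry X" "\<And>v. v \<in> X \<Longrightarrow> \<not> E v y" "\<And>v. v \<in> X \<Longrightarrow> \<not> E y v"
    using far_vertex by metis
  obtain x where x: "x \<in> X" using X_nonempty by blast
  show "separated (V - X - exits)"
  proof (rule separatedI[of _ y x])
    show "y \<in> V - X - exits" using y(1,2,4) unfolding exits_def by blast
    show "x \<notin> entry (V - X - exits)" using x sub unfolding exits_def by blast
  qed (use x X_subset y(5) in blast)+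
qed

lemma entry_le_exits: "card (entry X) \<le> card exits"
  using entry_le[OF separated_complement] card_mono[OF finite_exits entry_complement] by linarith

lemma min_separated_complement:
  "card exits \<le> card (entry X) \<Longrightarrow> min_separated (V - X - exits)"
  using card_mono[OF finite_exits entry_complement]
  by (intro min_separatedI[OF min_X separated_complement]) linarith

text \<open>
  The second layer, and what a vertex of \<open>X\<close> does not reach in two steps.
\<close>

definition exits2 :: "'a set" where "exits2 = {v. v \<notin> X \<and> v \<notin> exits \<and> (\<exists>u\<in>exits. E u v)}"

definition rest :: "'a set" where "rest = V - X - exits - exits2"

lemma exits2_subset: "exits2 \<subseteq> V"
  unfolding exits2_def using E_in_V by blast

lemma finite_exits2 [simp]: "finite exits2"
  by (rule finite_subset[OF exits2_subset finite_V])

lemma X_exits_disjoint: "X \<inter> exits = {}"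
  unfolding exits_def by blast

lemma exits2_disjoint: "(X \<union> exits) \<inter> exits2 = {}"
  unfolding exits2_def by blast

lemma entry_rest: "entry rest \<subseteq> exits2"
proof
  fix t assume "t \<in> entry rest"
  then obtain c where c: "t \<notin> rest" "c \<in> rest" "E t c" unfolding entry_def by blast
  have "t \<notin> X" using c(2,3) unfolding rest_def exits_def by blast
  moreover have "t \<notin> exits" using c(2,3) unfolding rest_def exits2_def by blast
  ultimately show "t \<in> exits2" using c(1) E_in_V[OF c(3)] unfolding rest_def by blast
qed

text \<open>
  A top scorer of \<open>X\<close> is a king of \<open>X\<close> and dominates all exits, whereas its in-neighbours are entries
  or among at most half of the other vertices of \<open>X\<close>.
\<close>

lemma reach_top_scorer:
  assumes x: "top_scorer X x"
  shows "card X + card exits + card exits2 \<le> card (reach x) + 1"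
    and "2 * card (In x) + 1 \<le> 2 * card (entry X) + card X"
proof -
  have k: "king X x" by (rule top_scorer_king[OF tournament_X x])
  have xX: "x \<in> X" by (rule king_mem[OF k])
  have sub: "(X - {x}) \<union> (exits \<union> exits2) \<subseteq> reach x"
  proof
    fix t assume "t \<in> (X - {x}) \<union> (exits \<union> exits2)"
    then consider "t \<in> X" "t \<noteq> x" | "t \<in> exits" | u where "u \<in> exits" "E u t"
      unfolding exits2_def by blast
    then show "t \<in> reach x"
    proof cases
      case 1
      then have "E x t \<or> (\<exists>m. E x m \<and> E m t)" using k unfolding king_def by blast
      then show ?thesis unfolding reach_def Out_def by blast
    next
      case 2
      then show ?thesis using X_to_exits[OF xX] unfolding reach_def Out_def by blast
    next
      case 3
      then show ?thesis using X_to_exits[OF xX] unfolding reach_def Out_def by blast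
    qed
  qed
  have "card ((X - {x}) \<union> (exits \<union> exits2)) = card (X - {x}) + (card exits + card exits2)"
  proof -
    have "card (exits \<union> exits2) = card exits + card exits2"
      by (rule card_Un_disjoint) (use exits2_disjoint in auto)
    moreover have "card ((X - {x}) \<union> (exits \<union> exits2)) = card (X - {x}) + card (exits \<union> exits2)"
    proof (rule card_Un_disjoint)
      show "(X - {x}) \<inter> (exits \<union> exits2) = {}"
        using X_exits_disjoint exits2_disjoint by blast
    qed simp_all
    ultimately show ?thesis by simp
  qed
  then show "card X + card exits + card exits2 \<le> card (reach x) + 1"
    using card_mono[OF finite_reach sub] card_Suc_Diff1[OF finite_X xX] by linarith
  have "In x \<subseteq> entry X \<union> (In x \<inter> X)" using xX unfolding In_def entry_def by blast
  then have "card (In x) \<le> card (entry X \<union> (In x \<inter> X))" by (intro card_mono) simp_all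
  also have "\<dots> \<le> card (entry X) + card (In x \<inter> X)" by (rule card_Un_le)
  finally show "2 * card (In x) + 1 \<le> 2 * card (entry X) + card X"
    using top_scorer_In[OF tournament_X x] by linarith
qed

text \<open>
  The configuration in which \<open>rest\<close> is not separated. Here \<open>rest\<close> is a tournament that dominates \<open>X\<close> and
  all exits, so its top scorer \<open>z\<close> reaches every vertex in two steps, and it is entered only from
  \<open>exits2\<close>. The size of \<open>exits2\<close> counts in favour of a top scorer \<open>x\<close> of \<open>X\<close> and against \<open>z\<close>; in the sum
  it cancels, and the surpluses of \<open>x\<close> and \<open>z\<close> add up to at least one. By integrality both are
  nonnegative or one is at least two.
\<close>

lemma ample_if_rest_adjacent:
  assumes ne: "rest \<noteq> {}" and adj: "\<And>p q. p \<in> rest \<Longrightarrow> q \<in> X \<union> exits \<Longrightarrow> E p q \<or> E q p"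
  shows ample
proof -
  have to_X: "E p d" if "p \<in> rest" "d \<in> X" for p d
    using adj[of p d] that unfolding rest_def exits_def by blast
  have to_exits: "E p u" if "p \<in> rest" "u \<in> exits" for p u
    using adj[of p u] that unfolding rest_def exits2_def by blast
  obtain x where x: "top_scorer X x" using top_scorer_exists[OF tournament_X X_nonempty] .
  have xX: "x \<in> X" using x by (simp add: top_scorer_def)
  have "rest \<subseteq> In x" using to_X xX unfolding In_def by blast
  then have T: "tournament_on rest" by (rule tournament_In)
  obtain z where z: "top_scorer rest z" using top_scorer_exists[OF T ne] .
  have k: "king rest z" by (rule top_scorer_king[OF T z])
  have zr: "z \<in> rest" by (rule king_mem[OF k])
  have zV: "z \<in> V" using zr unfolding rest_def by blast
  have "V - {z} \<subseteq> reach z"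
  proof
    fix t assume "t \<in> V - {z}"
    then consider "t \<in> rest" "t \<noteq> z" | "t \<in> X" | "t \<in> exits" | u where "u \<in> exits" "E u t"
      unfolding rest_def exits2_def by blast
    then show "t \<in> reach z"
    proof cases
      case 1
      then have "E z t \<or> (\<exists>m. E z m \<and> E m t)" using k unfolding king_def by blast
      then show ?thesis unfolding reach_def Out_def by blast
    next
      case 2
      then show ?thesis using to_X[OF zr] unfolding reach_def Out_def by blast
    next
      case 3
      then show ?thesis using to_exits[OF zr] unfolding reach_def Out_def by blast
    next
      case 4
      then show ?thesis using to_exits[OF zr] unfolding reach_def Out_def by blast
    qed
  qed
  then have rz: "card V \<le> card (reach z) + 1"
    using card_mono[OF finite_reach, of "V - {z}" z] card_Suc_Diff1[OF finite_V zV] by linarith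
  have "In z \<subseteq> exits2 \<union> (In z \<inter> rest)"
  proof
    fix t assume "t \<in> In z"
    then have t: "E t z" by (simp add: In_def)
    show "t \<in> exits2 \<union> (In z \<inter> rest)"
    proof (cases "t \<in> rest")
      case True then show ?thesis using \<open>t \<in> In z\<close> by blast
    next
      case False
      then show ?thesis using entry_rest t zr unfolding entry_def by blast
    qed
  qed
  then have "card (In z) \<le> card (exits2 \<union> (In z \<inter> rest))" by (intro card_mono) simp_all
  also have "\<dots> \<le> card exits2 + card (In z \<inter> rest)" by (rule card_Un_le)
  finally have iz: "2 * card (In z) + 1 \<le> 2 * card exits2 + card rest"
    using top_scorer_In[OF T z] by linarith
  have "card V = card X + card exits + card exits2 + card rest"
  proof -
    have V: "V = ((X \<union> exits) \<union> exits2) \<union> rest"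
      using X_subset exits_subset exits2_subset unfolding rest_def by blast
    have "card (((X \<union> exits) \<union> exits2) \<union> rest) = card ((X \<union> exits) \<union> exits2) + card rest"
    proof (rule card_Un_disjoint)
      show "finite rest" by (rule tournament_finite[OF T])
      show "((X \<union> exits) \<union> exits2) \<inter> rest = {}" unfolding rest_def by blast
    qed simp_all
    moreover have "card ((X \<union> exits) \<union> exits2) = card (X \<union> exits) + card exits2"
      by (rule card_Un_disjoint) (use exits2_disjoint in simp_all)
    moreover have "card (X \<union> exits) = card X + card exits"
      by (rule card_Un_disjoint) (use X_exits_disjoint in simp_all)
    ultimately show ?thesis using V by simp
  qed
  note rx = reach_top_scorer[OF x]
  have pos: "card X > 0" using X_nonempty by (simp add: card_gt_0_iff)
  have sum: "2 * card (In x) + 2 * card (In z) + 1 \<le> card (reach x) + card (reach z)"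
    using rx rz iz \<open>card V = _\<close> pos entry_le_exits by linarith
  have "x \<noteq> z" using xX zr unfolding rest_def by blast
  have xV: "x \<in> V" using xX X_subset by blast
  show ample
  proof (cases "2 * card (In x) \<le> card (reach x) \<and> 2 * card (In z) \<le> card (reach z)")
    case True
    then show ?thesis unfolding ample_def sullivan2_def using \<open>x \<noteq> z\<close> xV zV by blast
  next
    case False
    then have "2 * card (In x) + 2 \<le> card (reach x) \<or> 2 * card (In z) + 2 \<le> card (reach z)"
      using sum by linarith
    then show ?thesis unfolding ample_def using xV zV by blast
  qed
qed

text \<open>
  If \<open>rest\<close> is empty, the second layer contains all entries and a vertex nonadjacent to \<open>X\<close>. Otherwise,
  outside the configuration of the previous lemma, \<open>rest\<close> is itself separated, with its entries in
  the second layer.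
\<close>

lemma entry_le_exits2:
  assumes "\<not> ample"
  shows "card (entry X) \<le> card exits2 \<and>
    (card exits2 \<le> card (entry X) \<longrightarrow> (\<exists>Y. min_separated Y \<and> Y \<inter> X = {}))"
proof (cases "rest = {}")
  case True
  obtain y where y: "y \<in> V" "y \<notin> X" "y \<notin> entry X" "\<And>v. v \<in> X \<Longrightarrow> \<not> E v y"
    using far_vertex by metis
  have "y \<notin> exits" using y(4) unfolding exits_def by blast
  have "entry X \<inter> X = {}" unfolding entry_def by blast
  then have "insert y (entry X) \<subseteq> exits2"
    using True y(1,2) \<open>y \<notin> exits\<close> exits_disjoint_entry entry_subset[of X] unfolding rest_def by blast
  then have "card (insert y (entry X)) \<le> card exits2" by (intro card_mono) simp_all
  then show ?thesis using y(3) by simp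
next
  case False
  then obtain p q where pq: "p \<in> rest" "q \<in> X \<union> exits" "\<not> E p q"
    using ample_if_rest_adjacent assms by blast
  have "separated rest"
  proof (rule separatedI[OF _ pq(1) _ _ _ pq(3)])
    show "rest \<subseteq> V" unfolding rest_def by blast
    show "q \<in> V" using pq(2) X_subset exits_subset by blast
    show "q \<notin> rest" using pq(2) unfolding rest_def by blast
    show "q \<notin> entry rest" using pq(2) entry_rest unfolding exits2_def by blast
  qed
  moreover have "card (entry rest) \<le> card exits2" by (rule card_mono[OF finite_exits2 entry_rest])
  moreover have "rest \<inter> X = {}" unfolding rest_def by blast
  ultimately show ?thesis
    using entry_le min_separatedI[OF min_X] by (metis le_trans)
qed

lemma sullivan2_in_atom: "ample \<or> (\<exists>x\<in>X. sullivan2 x)"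
proof (cases ample)
  case False
  obtain x where x: "top_scorer X x" using top_scorer_exists[OF tournament_X X_nonempty] .
  have xX: "x \<in> X" using x by (simp add: top_scorer_def)
  then have "sullivan2 x"
    using reach_top_scorer[OF x] entry_le_exits entry_le_exits2[OF False] X_subset
    unfolding sullivan2_def by auto
  then show ?thesis using xX by blast
qed blast

text \<open>
  A top scorer of \<open>X\<close> has a surplus of two unless one of the two layers has just the minimum size;
  then the part of the digraph behind that layer is a minimum separated set.
\<close>

lemma disjoint_min_separated: "ample \<or> (\<exists>Y. min_separated Y \<and> Y \<inter> X = {})"
proof (rule ccontr)
  assume neg: "\<not> ?thesis"
  then have ng: "\<not> ample" and nd: "\<not> (\<exists>Y. min_separated Y \<and> Y \<inter> X = {})" by blast+
  have "\<not> card exits2 \<le> card (entry X)" using entry_le_exits2[OF ng] nd by blast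
  then have "card (entry X) + 1 \<le> card exits2" by linarith
  moreover have "card (entry X) + 1 \<le> card exits"
  proof (rule ccontr)
    assume "\<not> ?thesis"
    then have "min_separated (V - X - exits)" by (intro min_separated_complement) linarith
    moreover have "(V - X - exits) \<inter> X = {}" by blast
    ultimately show False using nd by blast
  qed
  moreover obtain x where x: "top_scorer X x" using top_scorer_exists[OF tournament_X X_nonempty] .
  ultimately have "2 * card (In x) + 2 \<le> card (reach x)" using reach_top_scorer[OF x] by linarith
  moreover have "x \<in> V" using x X_subset unfolding top_scorer_def by blast
  ultimately show False using ng unfolding ample_def by blast
qed

end

context strong_local_tournament
begin

text \<open>
  Two disjoint atoms contribute one Sullivan-2 vertex each.
\<close>

lemma ample_nontournament:
  assumes "x \<in> V" "y \<in> V" "x \<noteq> y" "\<not> E x y" "\<not> E y x"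
  shows ample
proof (rule ccontr)
  assume neg: "\<not> ample"
  obtain M where "min_separated M" using min_separated_exists[OF assms] by blast
  then obtain X where X: "atom X" using atom_exists[of M] by blast
  interpret X: separation_atom V E X by unfold_locales (rule X)
  obtain Y where Y: "min_separated Y" "Y \<inter> X = {}" using X.disjoint_min_separated neg by blast
  obtain Z where Z: "Z \<subseteq> Y" "atom Z" using atom_exists[OF Y(1)] by blast
  interpret Z: separation_atom V E Z by unfold_locales (rule Z(2))
  obtain a where a: "a \<in> X" "sullivan2 a" using X.sullivan2_in_atom neg by blast
  obtain b where b: "b \<in> Z" "sullivan2 b" using Z.sullivan2_in_atom neg by blast
  have "a \<noteq> b" using a(1) b(1) Z(1) Y(2) by blast
  then show False using neg a(2) b(2) unfolding ample_def by blast
qed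

lemma ample_if_several_vertices: "card V > 1 \<Longrightarrow> ample"
proof (cases "tournament_on V")
  case False
  then obtain x y where "x \<in> V" "y \<in> V" "x \<noteq> y" "\<not> E x y" "\<not> E y x"
    unfolding tournament_on_def by blast
  then show ample by (rule ample_nontournament)
qed (rule ample_tournament)

lemma sullivan2_exists:
  assumes "V \<noteq> {}" shows "\<exists>x. sullivan2 x"
proof (cases "tournament_on V")
  case True
  obtain k where "top_scorer V k" using top_scorer_exists[OF True assms] .
  then show ?thesis using sullivan2_top_scorer[OF True] by blast
next
  case False
  then obtain x y where "x \<in> V" "y \<in> V" "x \<noteq> y" "\<not> E x y" "\<not> E y x"
    unfolding tournament_on_def by blast
  then have ample by (rule ample_nontournament)
  then show ?thesis by (rule ample_imp_sullivan2)
qed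

end

section \<open>Transfer to digraphs\<close>

context local_tournament
begin

lemma dominates_in_verts: "u \<rightarrow>\<^bsub>G\<^esub> v \<Longrightarrow> u \<in> verts G \<and> v \<in> verts G"
  using adj_in_verts by blast

lemma dominates_induced: "u \<rightarrow>\<^bsub>G \<restriction> S\<^esub> v \<Longrightarrow> u \<rightarrow>\<^bsub>G\<^esub> v"
  by (auto simp: arcs_ends_conv)

lemma adjacent_out_nbrs:
  assumes "x \<rightarrow>\<^bsub>G\<^esub> v" "x \<rightarrow>\<^bsub>G\<^esub> w" "v \<noteq> w"
  shows "v \<rightarrow>\<^bsub>G\<^esub> w \<or> w \<rightarrow>\<^bsub>G\<^esub> v"
proof -
  have "semicomplete_digraph (G \<restriction> out_nbrs G x)"
    using out_semicomplete dominates_in_verts[OF assms(1)] by blast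
  then have "v \<rightarrow>\<^bsub>G \<restriction> out_nbrs G x\<^esub> w \<or> w \<rightarrow>\<^bsub>G \<restriction> out_nbrs G x\<^esub> v"
    by (rule semicomplete_digraph.semicomplete) (use assms in \<open>auto simp: out_nbrs_def\<close>)
  then show ?thesis using dominates_induced by blast
qed

lemma adjacent_in_nbrs:
  assumes "v \<rightarrow>\<^bsub>G\<^esub> x" "w \<rightarrow>\<^bsub>G\<^esub> x" "v \<noteq> w"
  shows "v \<rightarrow>\<^bsub>G\<^esub> w \<or> w \<rightarrow>\<^bsub>G\<^esub> v"
proof -
  have "semicomplete_digraph (G \<restriction> in_nbrs G x)"
    using in_semicomplete dominates_in_verts[OF assms(1)] by blast
  then have "v \<rightarrow>\<^bsub>G \<restriction> in_nbrs G x\<^esub> w \<or> w \<rightarrow>\<^bsub>G \<restriction> in_nbrs G x\<^esub> v"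
    by (rule semicomplete_digraph.semicomplete) (use assms in \<open>auto simp: in_nbrs_def\<close>)
  then show ?thesis using dominates_induced by blast
qed

lemma finite_out_nbrs: "finite (out_nbrs G x)"
  by (rule finite_subset[OF _ finite_verts]) (auto simp: out_nbrs_def dest: dominates_in_verts)

lemma finite_second_out_nbrs: "finite (second_out_nbrs G x)"
  unfolding second_out_nbrs_def using finite_out_nbrs by simp

lemma finite_sullivan: "finite {v. sullivan1_vertex G v}" "finite {v. sullivan2_vertex G v}"
  by (rule finite_subset[OF _ finite_verts], auto simp: sullivan1_vertex_def sullivan2_vertex_def)+

end

text \<open>
  An initial strong component, described as a minimal nonempty set closed under in-neighbours.
\<close>

locale initial_component = local_tournament +
  fixes C
  assumes C_subset: "C \<subseteq> verts G"
    and C_in_closed: "u \<rightarrow>\<^bsub>G\<^esub> v \<Longrightarrow> v \<in> C \<Longrightarrow> u \<in> C"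
    and C_minimal: "B \<subseteq> C \<Longrightarrow> B \<noteq> {} \<Longrightarrow> (\<And>u v. u \<rightarrow>\<^bsub>G\<^esub> v \<Longrightarrow> v \<in> B \<Longrightarrow> u \<in> B) \<Longrightarrow> B = C"
begin

definition E :: "'a \<Rightarrow> 'a \<Rightarrow> bool" where
  "E u v \<longleftrightarrow> u \<rightarrow>\<^bsub>G\<^esub> v \<and> u \<in> C \<and> v \<in> C"

sublocale C: strong_local_tournament C E
proof unfold_locales
  show "finite C" by (rule finite_subset[OF C_subset finite_verts])
  show "u \<in> C \<and> v \<in> C" if "E u v" for u v using that by (simp add: E_def)
  show "\<not> E v u" if "E u v" for u v using that no_two_cycle by (auto simp: E_def)
  show "E v w \<or> E w v" if "E u v" "E u w" "v \<noteq> w" for u v w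
    using that adjacent_out_nbrs[of u v w] by (auto simp: E_def)
  show "E v w \<or> E w v" if "E v u" "E w u" "v \<noteq> w" for u v w
    using that adjacent_in_nbrs[of v u w] by (auto simp: E_def)
  show "B = C" if B: "B \<subseteq> C" "B \<noteq> {}" and closed: "\<And>u v. E u v \<Longrightarrow> v \<in> B \<Longrightarrow> u \<in> B" for B
  proof (rule C_minimal[OF B])
    fix u v assume uv: "u \<rightarrow>\<^bsub>G\<^esub> v" "v \<in> B"
    then have "E u v" using C_in_closed[OF uv(1)] B(1) by (auto simp: E_def)
    then show "u \<in> B" using closed uv(2) by blast
  qed
qed

lemma in_degree_C: "x \<in> C \<Longrightarrow> in_degree G x = card (C.In x)"
proof -
  assume "x \<in> C"
  then have "in_nbrs G x = C.In x" using C_in_closed by (auto simp: in_nbrs_def C.In_def E_def)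
  then show ?thesis by (simp add: in_degree_eq_card_in_nbrs)
qed

lemma reach_C: "C.reach x \<subseteq> out_nbrs G x \<union> second_out_nbrs G x"
  by (auto simp: C.reach_def C.Out_def second_out_nbrs_def out_nbrs_def E_def)

lemma card_reach_le: "card (C.reach x) \<le> second_out_degree G x + out_degree G x"
proof -
  have "card (C.reach x) \<le> card (out_nbrs G x \<union> second_out_nbrs G x)"
    using finite_out_nbrs finite_second_out_nbrs by (intro card_mono[OF _ reach_C]) simp
  also have "\<dots> \<le> card (out_nbrs G x) + card (second_out_nbrs G x)" by (rule card_Un_le)
  finally show ?thesis by (simp add: second_out_degree_def out_degree_eq_card_out_nbrs)
qed

lemma sullivan2_transfer: "C.sullivan2 x \<Longrightarrow> sullivan2_vertex G x"
  using C_subset card_reach_le[of x] in_degree_C[of x]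
  by (auto simp: C.sullivan2_def sullivan2_vertex_def)

lemma sullivan1_transfer:
  assumes "C.sullivan1 x" shows "sullivan1_vertex G x"
proof -
  have x: "x \<in> C" "card (C.Out x) + card (C.In x) \<le> card (C.reach x)"
    using assms by (auto simp: C.sullivan1_def)
  have "C.reach x - C.Out x \<subseteq> second_out_nbrs G x"
    using x(1) by (auto simp: C.reach_def C.Out_def second_out_nbrs_def out_nbrs_def E_def)
  then have "card (C.reach x - C.Out x) \<le> second_out_degree G x"
    unfolding second_out_degree_def by (rule card_mono[OF finite_second_out_nbrs])
  moreover have "card (C.reach x - C.Out x) = card (C.reach x) - card (C.Out x)"
    by (rule card_Diff_subset[OF C.finite_Out C.Out_subset_reach])
  ultimately show ?thesis
    using x C_subset in_degree_C[OF x(1)] by (auto simp: sullivan1_vertex_def)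
qed

lemma large_if_no_source:
  assumes "C \<noteq> {}" "\<forall>v\<in>verts G. in_degree G v \<noteq> 0"
  shows "card C > 1"
proof -
  obtain x where x: "x \<in> C" using assms(1) by blast
  then have "x \<in> verts G" using C_subset by blast
  then have "in_degree G x \<noteq> 0" using assms(2) by blast
  then have "C.In x \<noteq> {}" using in_degree_C[OF x] by force
  then obtain a where a: "a \<in> C.In x" by blast
  then have "a \<in> C" "a \<noteq> x" using C.In_subset C.not_in_In by blast+
  then have "card {a, x} \<le> card C" using x by (intro card_mono[OF C.finite_V]) blast
  then show ?thesis using \<open>a \<noteq> x\<close> by simp
qed

end

lemma (in local_tournament) initial_component_exists:
  assumes "verts G \<noteq> {}"
  obtains C where "C \<noteq> {}" "initial_component G C"
proof -
  define closed where "closed B \<longleftrightarrow> B \<subseteq> verts G \<and> B \<noteq> {} \<and> (\<forall>u v. u \<rightarrow>\<^bsub>G\<^esub> v \<longrightarrow> v \<in> B \<longrightarrow> u \<in> B)" for B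
  have "closed (verts G)" using assms dominates_in_verts unfolding closed_def by blast
  from ex_has_least_nat[of closed, OF this, of card] obtain C where
    C: "closed C" and least: "\<And>B. closed B \<Longrightarrow> card C \<le> card B" by blast
  have fin: "finite C" using C finite_subset[OF _ finite_verts] unfolding closed_def by blast
  have "initial_component G C"
  proof (intro initial_component.intro initial_component_axioms.intro)
    show "local_tournament G" by unfold_locales
    show "C \<subseteq> verts G" using C unfolding closed_def by blast
    show "u \<in> C" if "u \<rightarrow>\<^bsub>G\<^esub> v" "v \<in> C" for u v using C that unfolding closed_def by blast
    show "B = C" if B: "B \<subseteq> C" "B \<noteq> {}" "\<And>u v. u \<rightarrow>\<^bsub>G\<^esub> v \<Longrightarrow> v \<in> B \<Longrightarrow> u \<in> B" for B
    proof (rule card_seteq[OF fin B(1)])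
      have "closed B" using B C unfolding closed_def by blast
      then show "card C \<le> card B" by (rule least)
    qed
  qed
  moreover have "C \<noteq> {}" using C unfolding closed_def by blast
  ultimately show thesis by (intro that)
qed

lemma card_ge_2I:
  assumes "finite S" "x \<in> S" "y \<in> S" "x \<noteq> y" shows "card S \<ge> 2"
proof -
  have "card {x, y} \<le> card S" using assms by (intro card_mono) auto
  then show ?thesis using assms(4) by simp
qed

theorem theorem5p1:
  fixes D :: "('a,'b) pre_digraph"
  assumes "local_tournament D" and "verts D \<noteq> {}"
  shows "((\<exists>v. sullivan1_vertex D v) \<and> (\<exists>v. sullivan2_vertex D v)) \<and>
    ((\<forall>v\<in>verts D. in_degree D v \<noteq> 0) \<longrightarrow> card {v. sullivan1_vertex D v} \<ge> 2) \<and>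
    ((\<forall>v\<in>verts D. in_degree D v \<noteq> 0) \<longrightarrow>
       card {v. sullivan2_vertex D v} \<ge> 2 \<or>
       (\<exists>v. sullivan2_vertex D v \<and>
            second_out_degree D v + out_degree D v \<ge> 2 * in_degree D v + 2))"
proof -
  interpret local_tournament D by (rule assms(1))
  obtain C where ne: "C \<noteq> {}" and "initial_component D C"
    using initial_component_exists[OF assms(2)] .
  then interpret initial_component D C by simp
  have "\<exists>v. sullivan1_vertex D v"
    using C.sullivan1_exists[OF ne] sullivan1_transfer by metis
  moreover have "\<exists>v. sullivan2_vertex D v"
    using C.sullivan2_exists[OF ne] sullivan2_transfer by blast
  moreover have "card {v. sullivan1_vertex D v} \<ge> 2" if no_source: "\<forall>v\<in>verts D. in_degree D v \<noteq> 0"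
  proof -
    obtain x y where "x \<noteq> y" "C.sullivan1 x" "C.sullivan1 y"
      using C.two_sullivan1[OF large_if_no_source[OF ne no_source]] by blast
    then show ?thesis
      using sullivan1_transfer by (intro card_ge_2I[OF finite_sullivan(1), of x y]) auto
  qed
  moreover have "card {v. sullivan2_vertex D v} \<ge> 2 \<or>
       (\<exists>v. sullivan2_vertex D v \<and>
            second_out_degree D v + out_degree D v \<ge> 2 * in_degree D v + 2)"
    if no_source: "\<forall>v\<in>verts D. in_degree D v \<noteq> 0"
  proof -
    have "C.ample" by (rule C.ample_if_several_vertices[OF large_if_no_source[OF ne no_source]])
    then consider x y where "x \<noteq> y" "C.sullivan2 x" "C.sullivan2 y"
      | x where "x \<in> C" "2 * card (C.In x) + 2 \<le> card (C.reach x)"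
      unfolding C.ample_def by blast
    then show ?thesis
    proof cases
      case 1
      then have "card {v. sullivan2_vertex D v} \<ge> 2"
        using sullivan2_transfer by (intro card_ge_2I[OF finite_sullivan(2), of x y]) auto
      then show ?thesis ..
    next
      case 2
      then have "2 * in_degree D x + 2 \<le> second_out_degree D x + out_degree D x"
        using card_reach_le[of x] in_degree_C[of x] by linarith
      moreover have "C.sullivan2 x" using 2 by (simp add: C.sullivan2_def)
      ultimately show ?thesis using sullivan2_transfer by blast
    qed
  qed
  ultimately show ?thesis by blast
qed

end
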